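(* For any graph $G$, $\operatorname{edim}(G\odot K_1)\ge \operatorname{edim}(G)$, and this bound is sharp (i.e. there exist graphs $G$ for which equality holds).
   Context: Graphs are finite, simple and undirected. Edge metric dimension: for a graph $\Gamma=(V,E)$, $v\in V$ and $e=uw\in E$, put $d_\Gamma(e,v)=\min\{d_\Gamma(u,v),d_\Gamma(w,v)\}$. A vertex $w$ distinguishes edges $e_1,e_2$ if $d_\Gamma(w,e_1)\neq d_\Gamma(w,e_2)$. A nonempty set $S\subseteq V$ is an edge metric generator for $\Gamma$ if any two distinct edges of $\Gamma$ are distinguished by some vertex of $S$. The minimum cardinality of an edge metric generator is the edge metric dimension $\operatorname{edim}(\Gamma)$. The notion is defined primarily for connected graphs; for non-connected graphs the distance between vertices in different components is taken to be infinite. Corona product with $K_1$: $G\odot K_1$ is obtained from $G$ by adding, for each vertex $g$ of $G$, one new vertex adjacent only to $g$. *)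

theory Defs
  imports Main "HOL-Library.Extended_Nat"
begin

datatype 'a graph = Graph (verts: "'a set") (edges: "'a set set")

definition simple_graph :: "'a graph \<Rightarrow> bool" where
  "simple_graph G \<longleftrightarrow> finite (verts G) \<and> verts G \<noteq> {} \<and>
     (\<forall>e\<in>edges G. e \<subseteq> verts G \<and> card e = 2)"

definition path_betw :: "'a graph \<Rightarrow> 'a \<Rightarrow> 'a list \<Rightarrow> 'a \<Rightarrow> bool" where
  "path_betw G u p v \<longleftrightarrow> p \<noteq> [] \<and> hd p = u \<and> last p = v \<and> distinct p \<and> set p \<subseteq> verts G \<and>
     successively (\<lambda>x y. {x, y} \<in> edges G) p"

text \<open>The infimum over the empty set is \<open>\<infinity>\<close>, the distance between vertices in different
  components.\<close>

definition gdist :: "'a graph \<Rightarrow> 'a \<Rightarrow> 'a \<Rightarrow> enat" where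
  "gdist G u v = (INF p\<in>{p. path_betw G u p v}. enat (length p - 1))"

definition edist :: "'a graph \<Rightarrow> 'a set \<Rightarrow> 'a \<Rightarrow> enat" where
  "edist G e v = Min ((\<lambda>u. gdist G u v) ` e)"

definition distinguishes :: "'a graph \<Rightarrow> 'a \<Rightarrow> 'a set \<Rightarrow> 'a set \<Rightarrow> bool" where
  "distinguishes G w e1 e2 \<longleftrightarrow> edist G e1 w \<noteq> edist G e2 w"

definition edge_metric_generator :: "'a graph \<Rightarrow> 'a set \<Rightarrow> bool" where
  "edge_metric_generator G S \<longleftrightarrow> S \<noteq> {} \<and> S \<subseteq> verts G \<and>
     (\<forall>e1\<in>edges G. \<forall>e2\<in>edges G. e1 \<noteq> e2 \<longrightarrow> (\<exists>w\<in>S. distinguishes G w e1 e2))"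

definition edim :: "'a graph \<Rightarrow> nat" where
  "edim G = (LEAST k. \<exists>S. edge_metric_generator G S \<and> card S = k)"

text \<open>\<open>Inl g\<close> is the original vertex \<open>g\<close>, \<open>Inr g\<close> the new pendant vertex attached to it.\<close>

definition corona_K1 :: "'a graph \<Rightarrow> ('a + 'a) graph" where
  "corona_K1 G = Graph (verts G <+> verts G)
     ((`) Inl ` edges G \<union> (\<lambda>g. {Inl g, Inr g}) ` verts G)"

lemma simple_graph_corona_K1:
  assumes "simple_graph G"
  shows "simple_graph (corona_K1 G)"
  using assms by (fastforce simp: simple_graph_def corona_K1_def card_image)

lemma gdist_eq_0_iff:
  assumes "u \<in> verts G"
  shows "gdist G u v = 0 \<longleftrightarrow> u = v"
proof
  assume "u = v"
  with assms have "path_betw G u [u] v" by (simp add: path_betw_def)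
  then have "gdist G u v \<le> enat (length [u] - 1)"
    unfolding gdist_def by (intro INF_lower) simp
  then show "gdist G u v = 0" by (simp add: zero_enat_def[symmetric])
next
  assume "gdist G u v = 0"
  then have "gdist G u v < 1" by simp
  then obtain p where p: "path_betw G u p v" "enat (length p - 1) < 1"
    unfolding gdist_def INF_less_iff by auto
  then have "length p = 1"
    by (cases p) (auto simp: path_betw_def one_enat_def)
  with p(1) show "u = v" by (auto simp: path_betw_def length_Suc_conv)
qed

text \<open>The minimum in \<open>edim\<close> is therefore always attained.\<close>

lemma edge_metric_generator_verts:
  assumes "simple_graph G"
  shows "edge_metric_generator G (verts G)"
proof -
  have "\<exists>w\<in>verts G. distinguishes G w e f" if e: "e \<in> edges G" and f: "f \<in> edges G" and "e \<noteq> f" for e f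
  proof -
    from assms e f have *: "e \<subseteq> verts G" "f \<subseteq> verts G" "card e = 2" "card f = 2"
      by (auto simp: simple_graph_def)
    then have fin: "finite e" "finite f" "e \<noteq> {}" "f \<noteq> {}"
      by (auto intro: card_ge_0_finite)
    have "\<not> e \<subseteq> f" using card_subset_eq[OF fin(2)] * \<open>e \<noteq> f\<close> by metis
    then obtain w where w: "w \<in> e" "w \<notin> f" by auto
    have zero: "edist G h w = 0 \<longleftrightarrow> w \<in> h" if h: "h \<subseteq> verts G" "finite h" "h \<noteq> {}" for h
    proof -
      have "edist G h w = 0 \<longleftrightarrow> (\<exists>x\<in>h. gdist G x w = 0)"
        using h Min_le_iff[of "(\<lambda>u. gdist G u w) ` h" 0] by (auto simp: edist_def)
      also have "\<dots> \<longleftrightarrow> w \<in> h" using h(1) by (auto simp: gdist_eq_0_iff subset_iff)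
      finally show ?thesis .
    qed
    have "edist G e w \<noteq> edist G f w" using zero[of e] zero[of f] * fin w by metis
    then show ?thesis using w * by (auto simp: distinguishes_def)
  qed
  with assms show ?thesis by (simp add: edge_metric_generator_def simple_graph_def)
qed

end

theory Submission
  imports Defs
begin

text \<open>
  The corona changes distances from the edges of \<open>G\<close> at most by a shift: a path in
  \<open>G \<odot> K\<^sub>1\<close> between original vertices never visits a pendant vertex, since it could not leave it
  again, and a path from an original vertex to the pendant at \<open>g\<close> is a path to \<open>g\<close> followed by one
  more step. Hence, for an edge \<open>e\<close> of \<open>G\<close>, the distance from \<open>e\<close> to \<open>Inl g\<close> in the corona is the
  old distance to \<open>g\<close>, and that to \<open>Inr g\<close> is one more (\<open>edist_corona_K1_Inl\<close>,
  \<open>edist_corona_K1_Inr\<close>). So a pendant vertex distinguishes exactly the same edges of \<open>G\<close> as its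
  base, and projecting an edge metric generator of the corona onto \<open>G\<close>, which merges each pendant
  vertex with its base, yields an edge metric generator of \<open>G\<close> that is not larger.

  The bound is attained by \<open>K\<^sub>1\<close>: its corona is \<open>K\<^sub>2\<close>, which has a single edge, so any one vertex
  generates, while a generator is nonempty by definition.
\<close>

section \<open>Edge metric dimension\<close>

lemma edim_le_card:
  assumes "edge_metric_generator G S"
  shows "edim G \<le> card S"
  unfolding edim_def using assms by (intro Least_le) blast

lemma edim_attained:
  assumes "simple_graph G"
  obtains S where "edge_metric_generator G S" "card S = edim G"
proof -
  have "\<exists>k S. edge_metric_generator G S \<and> card S = k"
    using edge_metric_generator_verts[OF assms] by blast
  from LeastI_ex[OF this] that show thesis
    unfolding edim_def by blast
qed

lemma edim_pos:
  assumes "simple_graph G"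
  shows "edim G \<ge> 1"
proof -
  obtain S where S: "edge_metric_generator G S" "card S = edim G"
    using edim_attained[OF assms] .
  then have "finite S" "S \<noteq> {}"
    using assms by (auto simp: edge_metric_generator_def simple_graph_def intro: finite_subset)
  then show ?thesis
    using S(2) by (metis card_gt_0_iff less_eq_Suc_le One_nat_def)
qed

lemma edge_finite_nonempty:
  assumes "simple_graph G" "e \<in> edges G"
  shows "finite e" "e \<noteq> {}"
  using assms by (auto simp: simple_graph_def intro: card_ge_0_finite)

section \<open>Paths in the corona\<close>

lemma corona_edge_iff:
  "{Inl a, Inl b} \<in> edges (corona_K1 G) \<longleftrightarrow> {a, b} \<in> edges G"
  "{Inl a, Inr b} \<in> edges (corona_K1 G) \<longleftrightarrow> a = b \<and> a \<in> verts G"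
  "{Inr b, Inl a} \<in> edges (corona_K1 G) \<longleftrightarrow> a = b \<and> a \<in> verts G"
  "{Inr a, Inr b} \<notin> edges (corona_K1 G)"
proof -
  have "({Inl a, Inl b} :: ('a + 'a) set) = Inl ` e \<longleftrightarrow> e = {a, b}" for e
    using inj_image_eq_iff[OF inj_Inl, of "{a, b}" e] by auto
  then show "{Inl a, Inl b} \<in> edges (corona_K1 G) \<longleftrightarrow> {a, b} \<in> edges G"
    by (auto simp: corona_K1_def image_iff doubleton_eq_iff)
qed (auto simp: corona_K1_def image_iff doubleton_eq_iff)

lemma verts_corona_K1 [simp]:
  "Inl g \<in> verts (corona_K1 G) \<longleftrightarrow> g \<in> verts G"
  "Inr g \<in> verts (corona_K1 G) \<longleftrightarrow> g \<in> verts G"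
  by (auto simp: corona_K1_def)

text \<open>The only neighbour of a pendant vertex is its base, so a path that starts at an original
  vertex can reach a pendant vertex only as its last one.\<close>

lemma corona_path_cases:
  assumes "successively (\<lambda>x y. {x, y} \<in> edges (corona_K1 G)) (Inl u # xs)"
    and "distinct (Inl u # xs)"
  shows "\<exists>q. q \<noteq> [] \<and> (Inl u # xs = map Inl q \<or> Inl u # xs = map Inl q @ [Inr (last q)])"
  using assms
proof (induction xs arbitrary: u)
  case Nil
  show ?case by (rule exI[of _ "[u]"]) simp
next
  case (Cons x xs)
  show ?case
  proof (cases x)
    case (Inl v)
    have "successively (\<lambda>x y. {x, y} \<in> edges (corona_K1 G)) (Inl v # xs)"
      "distinct (Inl v # xs)"
      using Cons.prems Inl by simp_all
    from Cons.IH[OF this] obtain q where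
      "q \<noteq> []" "Inl v # xs = map Inl q \<or> Inl v # xs = map Inl q @ [Inr (last q)]"
      by (elim exE conjE)
    then show ?thesis
      unfolding Inl by (intro exI[of _ "u # q"]) simp
  next
    case (Inr g)
    with Cons.prems(1) have "g = u"
      by (simp add: corona_edge_iff)
    moreover have "xs = []"
    proof (cases xs)
      case (Cons y ys)
      \<comment> \<open>the step after the pendant vertex would have to return to \<open>Inl u\<close>\<close>
      with Cons.prems Inr \<open>g = u\<close> show ?thesis
        by (cases y) (auto simp: corona_edge_iff)
    qed
    ultimately show ?thesis
      using Inr by (intro exI[of _ "[u]"]) simp
  qed
qed

lemma path_betw_map_Inl:
  "path_betw (corona_K1 G) (Inl u) (map Inl q) (Inl v) \<longleftrightarrow> path_betw G u q v"
  by (cases "q = []")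
    (auto simp: path_betw_def hd_map last_map distinct_map successively_map corona_edge_iff)

lemma path_betw_snoc_Inr:
  assumes "q \<noteq> []"
  shows "path_betw (corona_K1 G) (Inl u) (map Inl q @ [Inr g]) (Inr g) \<longleftrightarrow> path_betw G u q g"
  using assms
  by (auto simp: path_betw_def hd_map last_map distinct_map successively_map
      successively_append_iff corona_edge_iff)

lemma corona_paths_Inl_Inl:
  "{p. path_betw (corona_K1 G) (Inl u) p (Inl v)} = map Inl ` {q. path_betw G u q v}"
proof (intro equalityI subsetI)
  fix p assume "p \<in> {p. path_betw (corona_K1 G) (Inl u) p (Inl v)}"
  then have p: "path_betw (corona_K1 G) (Inl u) p (Inl v)" by simp
  then obtain xs where "p = Inl u # xs"
    unfolding path_betw_def by (metis list.collapse)
  with p have "\<exists>q. q \<noteq> [] \<and> (p = map Inl q \<or> p = map Inl q @ [Inr (last q)])"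
    using corona_path_cases[of G u xs] by (simp only: path_betw_def)
  then obtain q where "q \<noteq> []" "p = map Inl q \<or> p = map Inl q @ [Inr (last q)]"
    by (elim exE conjE)
  then have "p = map Inl q"
    using p by (auto simp: path_betw_def)
  with p show "p \<in> map Inl ` {q. path_betw G u q v}"
    by (auto simp: path_betw_map_Inl)
qed (auto simp: path_betw_map_Inl)

lemma corona_paths_Inl_Inr:
  "{p. path_betw (corona_K1 G) (Inl u) p (Inr g)} =
    (\<lambda>q. map Inl q @ [Inr g]) ` {q. path_betw G u q g}"
proof (intro equalityI subsetI)
  fix p assume "p \<in> {p. path_betw (corona_K1 G) (Inl u) p (Inr g)}"
  then have p: "path_betw (corona_K1 G) (Inl u) p (Inr g)" by simp
  then obtain xs where "p = Inl u # xs"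
    unfolding path_betw_def by (metis list.collapse)
  with p have "\<exists>q. q \<noteq> [] \<and> (p = map Inl q \<or> p = map Inl q @ [Inr (last q)])"
    using corona_path_cases[of G u xs] by (simp only: path_betw_def)
  then obtain q where q: "q \<noteq> []" "p = map Inl q \<or> p = map Inl q @ [Inr (last q)]"
    by (elim exE conjE)
  then have "p = map Inl q @ [Inr g]"
    using p by (auto simp: path_betw_def last_map)
  with p q(1) show "p \<in> (\<lambda>q. map Inl q @ [Inr g]) ` {q. path_betw G u q g}"
    by (auto simp: path_betw_snoc_Inr)
next
  fix p assume "p \<in> (\<lambda>q. map Inl q @ [Inr g]) ` {q. path_betw G u q g}"
  then show "p \<in> {p. path_betw (corona_K1 G) (Inl u) p (Inr g)}"
    using path_betw_snoc_Inr by (fastforce simp: path_betw_def)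
qed

section \<open>Distances in the corona\<close>

lemma INF_eSuc: "(INF x\<in>A. eSuc (f x)) = eSuc (INF x\<in>A. f x)"
proof (cases "A = {}")
  case True
  then show ?thesis by (simp add: top_enat_def)
next
  case False
  \<comment> \<open>the infimum of a nonempty set of extended naturals is attained\<close>
  then obtain x where x: "x \<in> A" "(INF x\<in>A. f x) = f x"
    using wellorder_InfI[of _ "f ` A"] by (metis (no_types) image_iff all_not_in_conv)
  show ?thesis
  proof (rule antisym)
    show "(INF x\<in>A. eSuc (f x)) \<le> eSuc (INF x\<in>A. f x)"
      unfolding x(2) using x(1) by (rule INF_lower)
    show "eSuc (INF x\<in>A. f x) \<le> (INF x\<in>A. eSuc (f x))"
      by (intro INF_greatest) (simp add: INF_lower)
  qed
qed

lemma gdist_corona_K1_Inl: "gdist (corona_K1 G) (Inl u) (Inl v) = gdist G u v"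
  unfolding gdist_def corona_paths_Inl_Inl by (simp add: image_image)

lemma gdist_corona_K1_Inr: "gdist (corona_K1 G) (Inl u) (Inr g) = eSuc (gdist G u g)"
proof -
  have "gdist (corona_K1 G) (Inl u) (Inr g) = (INF q\<in>{q. path_betw G u q g}. enat (length q))"
    unfolding gdist_def corona_paths_Inl_Inr by (simp add: image_image)
  also have "\<dots> = (INF q\<in>{q. path_betw G u q g}. eSuc (enat (length q - 1)))"
    by (intro INF_cong) (auto simp: path_betw_def eSuc_enat)
  finally show ?thesis
    unfolding gdist_def INF_eSuc .
qed

lemma edist_corona_K1_Inl: "edist (corona_K1 G) (Inl ` e) (Inl g) = edist G e g"
  by (simp add: edist_def image_image gdist_corona_K1_Inl)

lemma edist_corona_K1_Inr:
  assumes "finite e" "e \<noteq> {}"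
  shows "edist (corona_K1 G) (Inl ` e) (Inr g) = eSuc (edist G e g)"
proof -
  have "mono eSuc" by (simp add: mono_def)
  then have "eSuc (Min ((\<lambda>u. gdist G u g) ` e)) = Min (eSuc ` (\<lambda>u. gdist G u g) ` e)"
    using assms by (intro mono_Min_commute) auto
  then show ?thesis
    by (simp add: edist_def image_image gdist_corona_K1_Inr)
qed

section \<open>Projecting generators of the corona\<close>

text \<open>The projection \<open>case_sum id id\<close> sends a pendant vertex to its base. It keeps the
  distinguishing power on edges of \<open>G\<close> because \<open>eSuc\<close> is injective, also at \<open>\<infinity>\<close>, the
  distance between different components.\<close>

lemma distinguishes_corona_K1_iff:
  assumes "simple_graph G" "e \<in> edges G" "f \<in> edges G"
  shows "distinguishes (corona_K1 G) w (Inl ` e) (Inl ` f) \<longleftrightarrow>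
    distinguishes G (case_sum id id w) e f"
  using edge_finite_nonempty[OF assms(1,2)] edge_finite_nonempty[OF assms(1,3)]
  by (cases w) (simp_all add: distinguishes_def edist_corona_K1_Inl edist_corona_K1_Inr)

lemma edge_metric_generator_project:
  fixes G :: "'a graph"
  assumes G: "simple_graph G" and S: "edge_metric_generator (corona_K1 G) S"
  shows "edge_metric_generator G (case_sum id id ` S)"
  unfolding edge_metric_generator_def
proof (intro conjI ballI impI)
  show "case_sum id id ` S \<noteq> {}"
    using S by (simp add: edge_metric_generator_def)
  have "S \<subseteq> verts G <+> verts G"
    using S by (simp add: edge_metric_generator_def corona_K1_def)
  then show "case_sum id id ` S \<subseteq> verts G"
    by auto
next
  fix e f assume ef: "e \<in> edges G" "f \<in> edges G" "e \<noteq> f"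
  let ?lift = "image (Inl :: 'a \<Rightarrow> 'a + 'a)"
  have "?lift e \<in> edges (corona_K1 G)" "?lift f \<in> edges (corona_K1 G)"
    using ef by (simp_all add: corona_K1_def)
  moreover have "?lift e \<noteq> ?lift f"
    using ef(3) by (simp add: inj_image_eq_iff)
  ultimately obtain w where "w \<in> S" "distinguishes (corona_K1 G) w (?lift e) (?lift f)"
    using S unfolding edge_metric_generator_def by metis
  then show "\<exists>w\<in>case_sum id id ` S. distinguishes G w e f"
    using distinguishes_corona_K1_iff[OF G ef(1,2)] by (metis imageI)
qed

lemma edim_le_edim_corona_K1:
  assumes "simple_graph G"
  shows "edim G \<le> edim (corona_K1 G)"
proof -
  obtain S where S: "edge_metric_generator (corona_K1 G) S" "card S = edim (corona_K1 G)"
    using edim_attained[OF simple_graph_corona_K1[OF assms]] .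
  have "finite S"
    using S(1) simple_graph_corona_K1[OF assms] finite_subset
    unfolding edge_metric_generator_def simple_graph_def by blast
  then have "card (case_sum id id ` S) \<le> card S"
    by (rule card_image_le)
  with edim_le_card[OF edge_metric_generator_project[OF assms S(1)]] S(2) show ?thesis
    by simp
qed

section \<open>The bound and its sharpness\<close>

lemma edim_corona_K1_single_vertex:
  "edim (corona_K1 (Graph {v} {})) = edim (Graph {v} {})"
proof (rule antisym)
  have G: "simple_graph (Graph {v} {})"
    by (simp add: simple_graph_def)
  have "edge_metric_generator (corona_K1 (Graph {v} {})) {Inl v}"
    by (auto simp: edge_metric_generator_def corona_K1_def)
  then have "edim (corona_K1 (Graph {v} {})) \<le> 1"
    using edim_le_card[of _ "{Inl v}"] by simp
  also have "1 \<le> edim (Graph {v} {})"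
    by (rule edim_pos[OF G])
  finally show "edim (corona_K1 (Graph {v} {})) \<le> edim (Graph {v} {})" .
  show "edim (Graph {v} {}) \<le> edim (corona_K1 (Graph {v} {}))"
    by (rule edim_le_edim_corona_K1[OF G])
qed

theorem theorem7:
  "(\<forall>G :: 'a graph. simple_graph G \<longrightarrow> edim (corona_K1 G) \<ge> edim G) \<and>
   (\<exists>G :: nat graph. simple_graph G \<and> edim (corona_K1 G) = edim G)"
proof (intro conjI allI impI)
  show "edim G \<le> edim (corona_K1 G)" if "simple_graph G" for G :: "'a graph"
    using that by (rule edim_le_edim_corona_K1)
  show "\<exists>G :: nat graph. simple_graph G \<and> edim (corona_K1 G) = edim G"
    by (rule exI[of _ "Graph {0} {}"])
      (simp add: simple_graph_def edim_corona_K1_single_vertex)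
qed

end
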